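(* Let $L \in \mathbb{R}$. The following statements hold. (i) If $L < 2$, then $0 < C_*(L) \leq C_H(L)$. Moreover, for $L<2$, the equality $C_*(L) = C_H(L)$ holds if and only if $L = 0$. (ii) If $L \geq 2$, then $0 < C_*(L) < 2$. In contrast, $C_H(L)$ is undefined at $L = 2$ (its denominator vanishes there) and satisfies $C_H(L) < 0$ for $L > 2$.
   Context: The real variable $L$ stands for the quantity $L_f(x) = f(x)f''(x)/f'(x)^2$, regarded as ranging over all of $\mathbb{R}$. The correction function $C_*$ of the proposed iterative method is defined for $L \in \mathbb{R}$ by $$C_*(L) = \frac{2}{1 + B(L)}, \qquad B(L) = \frac{1 - L + \frac{1}{2}L^2}{1 - L + L^2}\left(\sqrt{1 + L^2} - L\right).$$ Halley's correction function is $$C_H(L) = \frac{2}{2 - L}, \qquad L \neq 2.$$ *)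

theory Defs
  imports Complex_Main
begin

definition B_fun :: "real \<Rightarrow> real" where
  "B_fun L = (1 - L + (1/2) * L\<^sup>2) / (1 - L + L\<^sup>2) * (sqrt (1 + L\<^sup>2) - L)"

definition C_star :: "real \<Rightarrow> real" where
  "C_star L = 2 / (1 + B_fun L)"

definition halley_denom :: "real \<Rightarrow> real" where
  "halley_denom L = 2 - L"

(* A partial function: with the convention 2 / 0 = 0 a total version would take
   the value 0 at L = 2, where the correction function is undefined. *)
definition C_Halley :: "real \<rightharpoonup> real" where
  "C_Halley L = (if halley_denom L = 0 then None else Some (2 / halley_denom L))"

end

theory Submission
  imports Defs
begin

text \<open>Write \<open>N = 1 - L + L\<^sup>2/2\<close>, \<open>D = 1 - L + L\<^sup>2\<close> and \<open>s = sqrt (1 + L\<^sup>2)\<close>. Everything reduces to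
  \<open>B L \<ge> 1 - L\<close> with equality only at \<open>L = 0\<close>. After clearing the positive denominator \<open>D\<close> this says
  \<open>N s \<ge> R\<close> for \<open>R = 1 - L + L\<^sup>2 - L\<^sup>3/2\<close>, and it follows from \<open>(N s)\<^sup>2 - R\<^sup>2 = L\<^sup>4/4\<close>.\<close>

lemma quadratic_pos:
  fixes L :: real
  shows "0 < 1 - L + (1/2) * L\<^sup>2" and "0 < 1 - L + L\<^sup>2"
proof -
  have "1 - L + (1/2) * L\<^sup>2 = (1/2) * (L - 1)\<^sup>2 + 1/2"
    by (simp add: power2_diff field_simps)
  then show "0 < 1 - L + (1/2) * L\<^sup>2"
    by (simp add: add_nonneg_pos)
  have "1 - L + L\<^sup>2 = (L - 1/2)\<^sup>2 + 3/4"
    by (simp add: power2_diff field_simps)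
  then show "0 < 1 - L + L\<^sup>2"
    by (simp add: add_nonneg_pos)
qed

text \<open>Both factors are positive. Hence \<open>1 + B_fun L\<close> exceeds 1, which yields both
  bounds \<open>0 < C_star L\<close> and \<open>C_star L < 2\<close>.\<close>

lemma B_fun_pos: "0 < B_fun L"
proof -
  have "L < sqrt (1 + L\<^sup>2)"
    by (rule real_less_rsqrt) simp
  then show ?thesis
    unfolding B_fun_def using quadratic_pos[of L] by simp
qed

lemma B_fun_gt:
  assumes "L \<noteq> 0"
  shows "1 - L < B_fun L"
proof -
  define N where "N = 1 - L + (1/2) * L\<^sup>2"
  define D where "D = 1 - L + L\<^sup>2"
  define s where "s = sqrt (1 + L\<^sup>2)"
  define R where "R = 1 - L + L\<^sup>2 - (1/2) * L ^ 3"
  have "0 < N" "0 < D"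
    using quadratic_pos[of L] by (simp_all add: N_def D_def)
  have "(N * s)\<^sup>2 = N\<^sup>2 * (1 + L\<^sup>2)"
    by (simp add: s_def power_mult_distrib)
  also have "\<dots> = R\<^sup>2 + (1/4) * L ^ 4"
    unfolding N_def R_def by algebra
  finally have "R\<^sup>2 < (N * s)\<^sup>2"
    using assms by simp
  \<comment> \<open>\<open>R\<close> may be negative (as at \<open>L = 2\<close>); passing from
    squares to bases only requires the larger side to be nonnegative.\<close>
  moreover have "0 \<le> N * s"
    using \<open>0 < N\<close> by (simp add: s_def)
  ultimately have "R < N * s"
    by (rule power2_less_imp_less)
  \<comment> \<open>\<open>R\<close> collects all terms without \<open>s\<close> once
    \<open>(1 - L) * D < N * (s - L)\<close> is rearranged.\<close>
  moreover have "R = (1 - L) * D + L * N"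
    unfolding R_def D_def N_def by algebra
  ultimately have "(1 - L) * D < N * (s - L)"
    by (simp add: algebra_simps)
  then have "1 - L < N * (s - L) / D"
    using \<open>0 < D\<close> by (simp add: pos_less_divide_eq)
  then show ?thesis
    by (simp add: B_fun_def N_def D_def s_def)
qed

lemma C_star_pos: "0 < C_star L"
  using B_fun_pos[of L] by (simp add: C_star_def)

lemma C_star_less_2: "C_star L < 2"
  using B_fun_pos[of L] by (simp add: C_star_def divide_simps)

lemma C_star_0: "C_star 0 = 1"
  by (simp add: C_star_def B_fun_def)

text \<open>Adding 1 to \<open>1 - L < B_fun L\<close> gives \<open>2 - L < 1 + B_fun L\<close>;
  since \<open>L < 2\<close>, both sides are positive and taking reciprocals reverses the
  order.\<close>

lemma C_star_less_Halley:
  assumes "L < 2" "L \<noteq> 0"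
  shows "C_star L < 2 / (2 - L)"
  unfolding C_star_def
  using assms B_fun_gt[of L] by (intro divide_strict_left_mono) auto

theorem proposition3p2:
  fixes L :: real
  shows "(L < 2 \<longrightarrow>
            0 < C_star L \<and>
            (\<exists>c. C_Halley L = Some c \<and> C_star L \<le> c) \<and>
            (C_Halley L = Some (C_star L) \<longleftrightarrow> L = 0)) \<and>
         (L \<ge> 2 \<longrightarrow> 0 < C_star L \<and> C_star L < 2) \<and>
         (halley_denom 2 = 0 \<and> C_Halley 2 = None) \<and>
         (L > 2 \<longrightarrow> (\<exists>c. C_Halley L = Some c \<and> c < 0))"
proof (cases "L = 0")
  case True
  then show ?thesis
    by (simp add: C_Halley_def halley_denom_def C_star_0)
next
  case False
  \<comment> \<open>Away from 0 the strict inequality gives the upper bound and also rules out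
    equality.\<close>
  then show ?thesis
    using C_star_pos[of L] C_star_less_2[of L] C_star_less_Halley[of L]
    by (auto simp: C_Halley_def halley_denom_def divide_pos_neg)
qed

end
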